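(* Let the subsystem $S$ be dynamically closed relative to frame $R_i$ (in some orientation $g_i$), i.e. the total Hamiltonian $H_{\bar i}=H_j\otimes\mathbf 1_S+\mathbf 1_j\otimes H_S$ relative to $R_i$ is non-interacting. Then the subsystem $S$ is dynamically closed also relative to frame $R_j$ (in any orientation $g_j$) if and only if $H_{\bar i}$ is of the form $$H_{\bar i}=H_j^{\mathbf d}\otimes\mathbf 1_S+\mathbf 1_j\otimes H_S^{\mathbf t}.$$ In other words, $S$ is dynamically open relative to frame $R_j$ if and only if at least one of the following holds: $$H_j^{\mathbf d\perp}\otimes\mathbf 1_S\neq0,\qquad \mathbf 1_j\otimes H_S^{\mathbf t\perp}\neq0.$$
   Context: $\mathcal G$ is a finite abelian group, $\mathcal G\neq\{e\}$. For $i=1,2$ (two ideal quantum reference frames $R_1,R_2$), $\mathcal H_i=\ell^2(\mathcal G)$ has orthonormal basis $\{|g\rangle_i\}_{g\in\mathcal G}$. $\mathcal H_S$ is a (possibly infinite-dimensional) complex Hilbert space carrying a unitary representation $g\mapsto U_S^g$ of $\mathcal G$; operators are bounded. For $i\neq j$ in $\{1,2\}$, $\mathcal H_{\bar i}=\mathcal H_j\otimes\mathcal H_S$ (the description of $R_j$ and $S$ relative to $R_i$). The frame change is the unitary $V_{i\to j}^{g_i,g_j}=\sum_{g\in\mathcal G}|gg_i\rangle_i\otimes\langle g_jg^{-1}|_j\otimes U_S^g:\mathcal H_{\bar i}\to\mathcal H_{\bar j}$. Hamiltonians are self-adjoint and time-independent; the Hamiltonian relative to $R_j$ in orientation $g_j$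 is $H_{\bar j}=V_{i\to j}^{g_i,g_j}H_{\bar i}(V_{i\to j}^{g_i,g_j})^\dagger$. $S$ is called dynamically closed relative to $R_j$ if $H_{\bar j}$ is non-interacting, i.e. of the form $H_i'\otimes\mathbf 1_S+\mathbf 1_i\otimes H_S'$ on $\mathcal H_{\bar j}=\mathcal H_i\otimes\mathcal H_S$, and dynamically open otherwise (and analogously relative to $R_i$). Notation: $H_j^{\mathbf d}=\sum_g|g\rangle\langle g|_jH_j|g\rangle\langle g|_j$ and $H_j^{\mathbf d\perp}=H_j-H_j^{\mathbf d}$ (diagonal and off-diagonal parts in the frame orientation basis); $H_S^{\mathbf t}=\frac1{|\mathcal G|}\sum_gU_S^gH_SU_S^{g^{-1}}$ and $H_S^{\mathbf t\perp}=H_S-H_S^{\mathbf t}$ (translation-invariant and non-invariant parts).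
   Formalization: The formal statement adds that no U_S^g with g ≠ e is a scalar multiple of the identity; without this the "only if" fails, e.g. for ℤ₂ acting trivially on H_S = ℂ with H_j = σ_x and zero Hamiltonian on S. *)

theory Defs
  imports "HOL-Analysis.Analysis"
begin

section \<open>Complex Hilbert spaces and operators\<close>

text \<open>The inner product is antilinear in its first argument. Positivity and definiteness
  are contained in \<open>cinner_self\<close>, since the norm is that of a Banach space.\<close>

class chilbert_space = banach +
  fixes scaleC :: "complex \<Rightarrow> 'a \<Rightarrow> 'a" (infixr "*\<^sub>C" 75)
    and cinner :: "'a \<Rightarrow> 'a \<Rightarrow> complex"
  assumes scaleC_add_right: "c *\<^sub>C (x + y) = c *\<^sub>C x + c *\<^sub>C y"
    and scaleC_add_left: "(c + d) *\<^sub>C x = c *\<^sub>C x + d *\<^sub>C x"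
    and scaleC_scaleC: "c *\<^sub>C (d *\<^sub>C x) = (c * d) *\<^sub>C x"
    and scaleC_of_real: "complex_of_real r *\<^sub>C x = r *\<^sub>R x"
    and cinner_commute: "cinner x y = cnj (cinner y x)"
    and cinner_add_right: "cinner x (y + z) = cinner x y + cinner x z"
    and cinner_scaleC_right: "cinner x (c *\<^sub>C y) = c * cinner x y"
    and cinner_self: "cinner x x = complex_of_real ((norm x)\<^sup>2)"

lemma scaleC_one [simp]: "1 *\<^sub>C x = (x :: 'a::chilbert_space)"
  using scaleC_of_real[of 1 x] by simp

lemma scaleC_zero_left [simp]: "0 *\<^sub>C x = (0 :: 'a::chilbert_space)"
  using scaleC_of_real[of 0 x] by simp

lemma scaleC_zero_right [simp]: "c *\<^sub>C 0 = (0 :: 'a::chilbert_space)"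
  using scaleC_add_right[of c 0 0] by simp

lemma cinner_zero_right [simp]: "cinner x (0 :: 'a::chilbert_space) = 0"
  using cinner_add_right[of x 0 0] by simp

lemma cinner_zero_left [simp]: "cinner (0 :: 'a::chilbert_space) x = 0"
  using cinner_commute[of 0 x] by simp

lemma cinner_add_left: "cinner (x + y) z = cinner x z + cinner y (z :: 'a::chilbert_space)"
  by (metis cinner_commute cinner_add_right complex_cnj_add)

lemma cinner_scaleC_left: "cinner (c *\<^sub>C x) y = cnj c * cinner x (y :: 'a::chilbert_space)"
  by (metis cinner_commute cinner_scaleC_right complex_cnj_mult)

lemma scaleC_sum_right: "c *\<^sub>C (\<Sum>i\<in>A. f i) = (\<Sum>i\<in>A. c *\<^sub>C (f i :: 'a::chilbert_space))"
  by (induction A rule: infinite_finite_induct) (auto simp: scaleC_add_right)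

lemma cinner_sum_right: "cinner x (\<Sum>i\<in>A. f i) = (\<Sum>i\<in>A. cinner x (f i :: 'a::chilbert_space))"
  by (induction A rule: infinite_finite_induct) (auto simp: cinner_add_right)

lemma cinner_diff_right: "cinner x (y - z) = cinner x y - cinner x (z :: 'a::chilbert_space)"
  using cinner_add_right[of x "y - z" z] by simp

lemma cinner_ext:
  fixes y z :: "'a::chilbert_space"
  assumes "\<And>x. cinner x y = cinner x z"
  shows "y = z"
proof -
  have "cinner (y - z) (y - z) = 0"
    using assms by (simp add: cinner_diff_right)
  then show ?thesis by (simp add: cinner_self)
qed

instantiation complex :: chilbert_space
begin

definition scaleC_complex :: "complex \<Rightarrow> complex \<Rightarrow> complex"
  where "scaleC_complex c x = c * x"

definition cinner_complex :: "complex \<Rightarrow> complex \<Rightarrow> complex"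
  where "cinner_complex x y = cnj x * y"

instance
  by standard
    (simp_all add: scaleC_complex_def cinner_complex_def algebra_simps scaleR_conv_of_real
      complex_mult_cnj cmod_power2 del: of_real_power)

end

instantiation vec :: (chilbert_space, finite) chilbert_space
begin

definition scaleC_vec :: "complex \<Rightarrow> 'a ^ 'b \<Rightarrow> 'a ^ 'b"
  where "scaleC_vec c x = (\<chi> i. c *\<^sub>C (x $ i))"

definition cinner_vec :: "'a ^ 'b \<Rightarrow> 'a ^ 'b \<Rightarrow> complex"
  where "cinner_vec x y = (\<Sum>i\<in>UNIV. cinner (x $ i) (y $ i))"

instance
proof
  fix x y :: "'a ^ 'b"
  show "cinner x y = cnj (cinner y x)"
    unfolding cinner_vec_def cnj_sum by (intro sum.cong refl cinner_commute)
  show "cinner x x = complex_of_real ((norm x)\<^sup>2)"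
    by (simp add: cinner_vec_def norm_vec_def L2_set_def cinner_self sum_nonneg del: of_real_power)
qed (simp_all add: vec_eq_iff scaleC_vec_def cinner_vec_def scaleC_add_right scaleC_add_left
      scaleC_scaleC scaleC_of_real cinner_add_right cinner_scaleC_right sum.distrib sum_distrib_left)

end

definition bounded_clinear :: "('a::chilbert_space \<Rightarrow> 'b::chilbert_space) \<Rightarrow> bool"
  where "bounded_clinear A \<longleftrightarrow> bounded_linear A \<and> (\<forall>c x. A (c *\<^sub>C x) = c *\<^sub>C A x)"

definition self_adjoint :: "('a::chilbert_space \<Rightarrow> 'a) \<Rightarrow> bool"
  where "self_adjoint A \<longleftrightarrow> bounded_clinear A \<and> (\<forall>x y. cinner (A x) y = cinner x (A y))"

definition unitary_op :: "('a::chilbert_space \<Rightarrow> 'b::chilbert_space) \<Rightarrow> bool"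
  where "unitary_op A \<longleftrightarrow>
    bounded_clinear A \<and> (\<forall>x y. cinner (A x) (A y) = cinner x y) \<and> surj A"

definition cadjoint :: "('a::chilbert_space \<Rightarrow> 'b::chilbert_space) \<Rightarrow> 'b \<Rightarrow> 'a"
  where "cadjoint A = (THE B. \<forall>x y. cinner (A x) y = cinner x (B y))"

lemma cadjoint_eqI:
  assumes "\<And>x y. cinner (A x) y = cinner x (B y)"
  shows "cadjoint A = B"
  unfolding cadjoint_def
proof (rule the_equality)
  fix B'
  assume "\<forall>x y. cinner (A x) y = cinner x (B' y)"
  with assms have "cinner x (B' y) = cinner x (B y)" for x y
    by metis
  then show "B' = B"
    by (intro ext) (rule cinner_ext)
qed (use assms in blast)

lemma cadjoint_unitary:
  assumes "unitary_op A"
  shows "cadjoint A (A x) = x" and "A (cadjoint A y) = y"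
    and "cinner (A x) y = cinner x (cadjoint A y)"
proof -
  have surj: "A (inv A y) = y" for y
    using assms by (simp add: unitary_op_def surj_f_inv_f)
  have adj: "cinner (A x) y = cinner x (inv A y)" for x y
    using assms surj[of y] unfolding unitary_op_def by metis
  have eq: "cadjoint A = inv A"
    by (rule cadjoint_eqI) (rule adj)
  show "A (cadjoint A y) = y"
    by (simp add: eq surj)
  show "cinner (A x) y = cinner x (cadjoint A y)"
    by (simp add: eq adj)
  have "cinner z (inv A (A x)) = cinner z x" for z
    using assms adj[of z "A x"] by (simp add: unitary_op_def)
  then show "cadjoint A (A x) = x"
    unfolding eq by (rule cinner_ext)
qed


section \<open>Tensor products with the frame space\<close>

text \<open>The group is a finite type \<open>'g\<close> written additively: \<open>g * h\<close>, \<open>inverse g\<close> and the unit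
  become \<open>g + h\<close>, \<open>- g\<close> and \<open>0\<close>. The frame space is \<open>complex ^ 'g\<close>, with the norm and inner
  product of \<open>l\<^sup>2\<close>, and its tensor product with \<open>'s\<close> is realised as \<open>'s ^ 'g\<close>: the component
  \<open>\<Phi> $ g\<close> is the partial inner product of \<open>\<Phi>\<close> with the basis vector \<open>ket g\<close>.
  As the frame space is finite-dimensional no completion is needed.\<close>

definition ket :: "'g::finite \<Rightarrow> complex ^ 'g"
  where "ket g = axis g 1"

definition ketbra :: "'g::finite \<Rightarrow> 'g \<Rightarrow> complex ^ 'g \<Rightarrow> complex ^ 'g"
  where "ketbra g h \<psi> = cinner (ket h) \<psi> *\<^sub>C ket g"

definition tensor_vec :: "complex ^ 'g::finite \<Rightarrow> 's::chilbert_space \<Rightarrow> 's ^ 'g"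
    (infixr "\<otimes>\<^sub>v" 70)
  where "f \<otimes>\<^sub>v \<psi> = (\<chi> g. (f $ g) *\<^sub>C \<psi>)"

text \<open>Every vector is the sum of the \<open>ket h \<otimes>\<^sub>v (\<Phi> $ h)\<close>; the product of two operators is
  defined by linear extension.\<close>

definition tensor_op ::
    "(complex ^ 'g::finite \<Rightarrow> complex ^ 'g) \<Rightarrow> ('s::chilbert_space \<Rightarrow> 's) \<Rightarrow> 's ^ 'g \<Rightarrow> 's ^ 'g"
    (infixr "\<otimes>\<^sub>o" 70)
  where "(A \<otimes>\<^sub>o B) \<Phi> = (\<Sum>h\<in>UNIV. A (ket h) \<otimes>\<^sub>v B (\<Phi> $ h))"

lemma ket_nth: "ket g $ h = (if h = g then 1 else 0)"
  by (auto simp: ket_def axis_def)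

lemma cinner_ket: "cinner (ket g) \<psi> = \<psi> $ g"
proof -
  have "cinner (ket g) \<psi> = (\<Sum>i\<in>UNIV. if i = g then \<psi> $ i else 0)"
    unfolding cinner_vec_def by (intro sum.cong) (auto simp: ket_nth cinner_complex_def)
  then show ?thesis by simp
qed

lemma ket_expansion: "(\<Sum>h\<in>UNIV. (f $ h) *\<^sub>C ket h) = f"
proof -
  have "(\<Sum>h\<in>UNIV. (f $ h) *\<^sub>C ket h) $ g = (\<Sum>h\<in>UNIV. if h = g then f $ h else 0)" for g
    unfolding sum_component by (intro sum.cong) (auto simp: scaleC_vec_def scaleC_complex_def ket_nth)
  then show ?thesis by (simp add: vec_eq_iff)
qed

lemma tensor_expansion: "(\<Sum>h\<in>UNIV. ket h \<otimes>\<^sub>v (\<Phi> $ h)) = \<Phi>"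
proof -
  have "(\<Sum>h\<in>UNIV. ket h \<otimes>\<^sub>v (\<Phi> $ h)) $ g = (\<Sum>h\<in>UNIV. if h = g then \<Phi> $ h else 0)" for g
    unfolding sum_component by (intro sum.cong) (auto simp: tensor_vec_def ket_nth)
  then show ?thesis by (simp add: vec_eq_iff)
qed

lemma cinner_tensor_vec: "cinner (f \<otimes>\<^sub>v \<psi>) (f' \<otimes>\<^sub>v \<psi>') = cinner f f' * cinner \<psi> \<psi>'"
proof -
  have "cinner ((f \<otimes>\<^sub>v \<psi>) $ g) ((f' \<otimes>\<^sub>v \<psi>') $ g) = cinner (f $ g) (f' $ g) * cinner \<psi> \<psi>'" for g
    by (simp only: tensor_vec_def vec_lambda_beta cinner_scaleC_left cinner_scaleC_right
        cinner_complex_def mult.assoc mult.left_commute)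
  then show ?thesis
    by (simp only: cinner_vec_def sum_distrib_right)
qed

lemma tensor_op_tensor_vec:
  fixes A :: "complex ^ 'g \<Rightarrow> complex ^ 'g" and B :: "'s::chilbert_space \<Rightarrow> 's"
  assumes "bounded_clinear A" and "bounded_clinear B"
  shows "(A \<otimes>\<^sub>o B) (f \<otimes>\<^sub>v \<psi>) = A f \<otimes>\<^sub>v B \<psi>"
proof -
  have "A f = (\<Sum>h\<in>UNIV. (f $ h) *\<^sub>C A (ket h))"
    using assms(1) bounded_linear.linear[of A] ket_expansion[of f] linear_sum[of A]
    unfolding bounded_clinear_def by (metis (mono_tags, lifting) sum.cong)
  then have "A f $ g = (\<Sum>h\<in>UNIV. A (ket h) $ g * f $ h)" for g
    by (simp add: sum_component scaleC_vec_def scaleC_complex_def mult.commute)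
  moreover have sum: "(\<Sum>h\<in>H. (c h :: complex) *\<^sub>C B \<psi>) = (\<Sum>h\<in>H. c h) *\<^sub>C B \<psi>"
    for c and H :: "'g set"
    by (induction H rule: infinite_finite_induct) (auto simp: scaleC_add_left)
  ultimately show ?thesis
    using assms(2)
    by (simp add: vec_eq_iff tensor_op_def tensor_vec_def bounded_clinear_def scaleC_scaleC)
qed


section \<open>Quantum reference frames\<close>

definition unitary_rep :: "('g::ab_group_add \<Rightarrow> 's::chilbert_space \<Rightarrow> 's) \<Rightarrow> bool"
  where "unitary_rep U \<longleftrightarrow>
    (\<forall>g. unitary_op (U g)) \<and> U 0 = id \<and> (\<forall>g h. U (g + h) = U g \<circ> U h)"

text \<open>The frame change \<open>V\<close> from frame \<open>i\<close> in orientation \<open>g\<^sub>i\<close> to frame \<open>j\<close> in orientation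
  \<open>g\<^sub>j\<close>. Both frame spaces are copies of the same space, so domain and codomain have the same
  type; the argument is a vector relative to \<open>i\<close> (first factor: frame \<open>j\<close>), the result one
  relative to \<open>j\<close> (first factor: frame \<open>i\<close>).\<close>

definition frame_change ::
    "('g::{finite,ab_group_add} \<Rightarrow> 's::chilbert_space \<Rightarrow> 's) \<Rightarrow> 'g \<Rightarrow> 'g
      \<Rightarrow> ('s, 'g) vec \<Rightarrow> ('s, 'g) vec"
  where "frame_change U g\<^sub>i g\<^sub>j \<Phi> = (\<Sum>g\<in>UNIV. (ketbra (g + g\<^sub>i) (g\<^sub>j - g) \<otimes>\<^sub>o U g) \<Phi>)"

definition changed_hamiltonian ::
    "('g::{finite,ab_group_add} \<Rightarrow> 's::chilbert_space \<Rightarrow> 's) \<Rightarrow> 'g \<Rightarrow> 'g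
      \<Rightarrow> (('s, 'g) vec \<Rightarrow> ('s, 'g) vec) \<Rightarrow> ('s, 'g) vec \<Rightarrow> ('s, 'g) vec"
  where "changed_hamiltonian U g\<^sub>i g\<^sub>j H =
    frame_change U g\<^sub>i g\<^sub>j \<circ> H \<circ> cadjoint (frame_change U g\<^sub>i g\<^sub>j)"

definition noninteracting ::
    "(complex ^ 'g::finite \<Rightarrow> complex ^ 'g) \<Rightarrow> ('s::chilbert_space \<Rightarrow> 's) \<Rightarrow> 's ^ 'g \<Rightarrow> 's ^ 'g"
  where "noninteracting A B \<Phi> = (A \<otimes>\<^sub>o id) \<Phi> + (id \<otimes>\<^sub>o B) \<Phi>"

definition dynamically_closed :: "('s::chilbert_space ^ 'g \<Rightarrow> 's ^ 'g) \<Rightarrow> bool"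
  where "dynamically_closed H \<longleftrightarrow>
    (\<exists>A B. self_adjoint A \<and> self_adjoint B \<and> H = noninteracting A B)"

definition dynamically_open :: "('s::chilbert_space ^ 'g \<Rightarrow> 's ^ 'g) \<Rightarrow> bool"
  where "dynamically_open H \<longleftrightarrow> \<not> dynamically_closed H"

definition diag_part :: "(complex ^ 'g::finite \<Rightarrow> complex ^ 'g) \<Rightarrow> complex ^ 'g \<Rightarrow> complex ^ 'g"
  where "diag_part H \<psi> = (\<Sum>g\<in>UNIV. ketbra g g (H (ketbra g g \<psi>)))"

definition offdiag_part :: "(complex ^ 'g::finite \<Rightarrow> complex ^ 'g) \<Rightarrow> complex ^ 'g \<Rightarrow> complex ^ 'g"
  where "offdiag_part H \<psi> = H \<psi> - diag_part H \<psi>"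

definition inv_part ::
    "('g::{finite,ab_group_add} \<Rightarrow> 's::chilbert_space \<Rightarrow> 's) \<Rightarrow> ('s \<Rightarrow> 's) \<Rightarrow> 's \<Rightarrow> 's"
  where "inv_part U H \<psi> = (1 / real CARD('g)) *\<^sub>R (\<Sum>g\<in>UNIV. U g (H (U (- g) \<psi>)))"

definition noninv_part ::
    "('g::{finite,ab_group_add} \<Rightarrow> 's::chilbert_space \<Rightarrow> 's) \<Rightarrow> ('s \<Rightarrow> 's) \<Rightarrow> 's \<Rightarrow> 's"
  where "noninv_part U H \<psi> = H \<psi> - inv_part U H \<psi>"

lemma frame_change_nth:
  assumes "unitary_rep U"
  shows "frame_change U g\<^sub>i g\<^sub>j \<Phi> $ (g + g\<^sub>i) = U g (\<Phi> $ (g\<^sub>j - g))"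
proof -
  have "(ketbra a b \<otimes>\<^sub>o U g) \<Phi> = ket a \<otimes>\<^sub>v U g (\<Phi> $ b)" for a b g
  proof -
    have "ketbra a b (ket h) \<otimes>\<^sub>v U g (\<Phi> $ h) = (if h = b then ket a \<otimes>\<^sub>v U g (\<Phi> $ h) else 0)" for h
      by (auto simp: ketbra_def cinner_ket ket_nth vec_eq_iff tensor_vec_def)
    then show ?thesis by (simp add: tensor_op_def)
  qed
  then have "frame_change U g\<^sub>i g\<^sub>j \<Phi> $ (g + g\<^sub>i)
      = (\<Sum>h\<in>UNIV. if h = g then U h (\<Phi> $ (g\<^sub>j - h)) else 0)"
    unfolding frame_change_def sum_component
    by (intro sum.cong) (auto simp: tensor_vec_def ket_nth)
  then show ?thesis by simp
qed

lemma unitary_frame_change: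
  fixes U :: "'g::{finite,ab_group_add} \<Rightarrow> 's::chilbert_space \<Rightarrow> 's"
  assumes "unitary_rep U"
  shows "unitary_op (frame_change U g\<^sub>i g\<^sub>j)"
proof -
  let ?V = "frame_change U g\<^sub>i g\<^sub>j"
  have U: "unitary_op (U g)" for g
    using assms by (simp add: unitary_rep_def)
  have lin: "U g (x + y) = U g x + U g y" "U g (r *\<^sub>R x) = r *\<^sub>R U g x"
    "U g (c *\<^sub>C x) = c *\<^sub>C U g x" for g x y r c
    using U[of g] bounded_linear.linear[of "U g"] linear_add[of "U g"] linear_scale[of "U g"]
    unfolding unitary_op_def bounded_clinear_def by blast+
  have nth: "?V \<Phi> $ k = U (k - g\<^sub>i) (\<Phi> $ (g\<^sub>j + g\<^sub>i - k))" for \<Phi> k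
    using frame_change_nth[OF assms, of g\<^sub>i g\<^sub>j \<Phi> "k - g\<^sub>i"] by (simp add: algebra_simps)
  have reindex: "(\<Sum>k\<in>UNIV. f (g\<^sub>j + g\<^sub>i - k)) = (\<Sum>k\<in>UNIV. f k)" for f :: "'g \<Rightarrow> complex"
    by (rule sum.reindex_bij_witness[of _ "\<lambda>k. g\<^sub>j + g\<^sub>i - k" "\<lambda>k. g\<^sub>j + g\<^sub>i - k"]) auto
  have inner: "cinner (?V \<Phi>) (?V \<Psi>) = cinner \<Phi> \<Psi>" for \<Phi> \<Psi>
    using U reindex[of "\<lambda>k. cinner (\<Phi> $ k) (\<Psi> $ k)"] by (simp add: cinner_vec_def nth unitary_op_def)
  have "norm (?V \<Phi>) = norm \<Phi>" for \<Phi>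
  proof -
    have "complex_of_real ((norm (?V \<Phi>))\<^sup>2) = complex_of_real ((norm \<Phi>)\<^sup>2)"
      using inner[of \<Phi> \<Phi>] by (simp only: cinner_self)
    then show ?thesis by (simp only: of_real_eq_iff power2_eq_iff_nonneg norm_ge_zero)
  qed
  moreover have "?V (\<Phi> + \<Psi>) = ?V \<Phi> + ?V \<Psi>" "?V (r *\<^sub>R \<Phi>) = r *\<^sub>R ?V \<Phi>"
    "?V (c *\<^sub>C \<Phi>) = c *\<^sub>C ?V \<Phi>" for \<Phi> \<Psi> r c
    by (simp_all add: vec_eq_iff nth scaleC_vec_def lin)
  ultimately have "bounded_clinear ?V"
    unfolding bounded_clinear_def by (intro conjI allI bounded_linear_intro[where K = 1]) simp_all
  moreover have "surj ?V"
  proof (rule surjI)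
    fix \<Psi>
    show "?V (\<chi> k. inv (U (g\<^sub>j - k)) (\<Psi> $ (g\<^sub>j + g\<^sub>i - k))) = \<Psi>"
      using U by (simp add: vec_eq_iff nth unitary_op_def surj_f_inv_f algebra_simps)
  qed
  ultimately show ?thesis
    using inner by (simp add: unitary_op_def)
qed

end

theory Submission
  imports Defs
begin

text \<open>In the frame orientation basis the transformed Hamiltonian has matrix entries
  \<open>a (c - k) (c - l) U (k - l)\<close> off the diagonal, where \<open>a\<close> is the matrix of \<open>H\<^sub>j\<close> and
  \<open>c = g\<^sub>j + g\<^sub>i\<close>, and \<open>a (c - k) (c - k) + U (k - g\<^sub>i) H\<^sub>S U (g\<^sub>i - k)\<close> on it. A non-interacting
  Hamiltonian has scalar off-diagonal entries; as no \<open>U g\<close> with \<open>g \<noteq> 0\<close> is scalar, \<open>H\<^sub>j\<close> must be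
  diagonal. Comparing the diagonal entries, each conjugate of \<open>H\<^sub>S\<close> differs from \<open>H\<^sub>S\<close> by a
  scalar; averaging over the group, \<open>H\<^sub>S\<close> differs from its invariant part by a scalar, so it is
  invariant itself.\<close>

section \<open>Scalar multiples and complex-linear maps\<close>

lemma scaleC_diff_left: "(c - d) *\<^sub>C x = c *\<^sub>C x - d *\<^sub>C (x :: 'a::chilbert_space)"
  using scaleC_add_left[of "c - d" d x] by simp

lemma scaleC_minus_left: "(- c) *\<^sub>C x = - (c *\<^sub>C (x :: 'a::chilbert_space))"
  using scaleC_diff_left[of 0 c x] by simp

lemma scaleC_sum_left: "(\<Sum>i\<in>A. f i) *\<^sub>C x = (\<Sum>i\<in>A. f i *\<^sub>C (x :: 'a::chilbert_space))"
  by (induction A rule: infinite_finite_induct) (auto simp: scaleC_add_left)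

lemma scaleC_eq_0_iff: "c *\<^sub>C x = 0 \<longleftrightarrow> c = 0 \<or> x = (0 :: 'a::chilbert_space)"
proof
  assume "c *\<^sub>C x = 0"
  then have "(inverse c * c) *\<^sub>C x = 0"
    by (metis scaleC_scaleC scaleC_zero_right)
  then show "c = 0 \<or> x = 0"
    by (cases "c = 0") auto
qed auto

lemma bounded_clinear_simps:
  assumes "bounded_clinear A"
  shows "A (x + y) = A x + A y" and "A (c *\<^sub>C x) = c *\<^sub>C A x"
    and "A (r *\<^sub>R x) = r *\<^sub>R A x" and "A 0 = 0" and "A (sum f I) = (\<Sum>i\<in>I. A (f i))"
proof -
  have "linear A"
    using assms bounded_linear.linear[of A] by (simp add: bounded_clinear_def)
  then show "A (x + y) = A x + A y" "A (r *\<^sub>R x) = r *\<^sub>R A x" "A 0 = 0"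
    "A (sum f I) = (\<Sum>i\<in>I. A (f i))"
    by (simp_all add: linear_add linear_scale linear_0 linear_sum)
  show "A (c *\<^sub>C x) = c *\<^sub>C A x"
    using assms by (simp add: bounded_clinear_def)
qed

section \<open>Matrix entries in the frame orientation basis\<close>

lemma tensor_op_id_right_nth:
  "(A \<otimes>\<^sub>o id) \<Phi> $ m = (\<Sum>h\<in>UNIV. (A (ket h) $ m) *\<^sub>C (\<Phi> $ h))"
  by (simp add: tensor_op_def tensor_vec_def)

lemma tensor_op_id_left_nth: "(id \<otimes>\<^sub>o B) \<Phi> $ m = B (\<Phi> $ m)"
proof -
  have "(id \<otimes>\<^sub>o B) \<Phi> $ m = (\<Sum>h\<in>UNIV. if h = m then B (\<Phi> $ h) else 0)"
    unfolding tensor_op_def sum_component by (intro sum.cong) (auto simp: tensor_vec_def ket_nth)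
  then show ?thesis by simp
qed

lemma noninteracting_nth:
  "noninteracting A B \<Phi> $ m = (\<Sum>h\<in>UNIV. (A (ket h) $ m) *\<^sub>C (\<Phi> $ h)) + B (\<Phi> $ m)"
  by (simp add: noninteracting_def tensor_op_id_right_nth tensor_op_id_left_nth)

text \<open>\<open>axis l \<psi>\<close> is the product vector
  \<open>ket l \<otimes>\<^sub>v \<psi>\<close>, the test vector that picks out column
  \<open>l\<close> of a block matrix; the terms at its zero components drop out.\<close>

lemma sum_axis:
  fixes f :: "'g::finite \<Rightarrow> 'a::zero \<Rightarrow> 'b::comm_monoid_add"
  assumes "\<And>h. f h 0 = 0"
  shows "(\<Sum>h\<in>UNIV. f h (axis l \<psi> $ h)) = f l \<psi>"
proof -
  have "(\<Sum>h\<in>UNIV. f h (axis l \<psi> $ h)) = (\<Sum>h\<in>UNIV. if h = l then f h \<psi> else 0)"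
    using assms by (intro sum.cong) (auto simp: axis_def)
  then show ?thesis by simp
qed

text \<open>The conditional stays inside \<open>B\<close> because without linearity
  \<open>B 0\<close> may be nonzero off the diagonal.\<close>

lemma noninteracting_axis_nth:
  "noninteracting A B (axis h \<psi>) $ m = (A (ket h) $ m) *\<^sub>C \<psi> + B (if m = h then \<psi> else 0)"
  unfolding noninteracting_nth by (subst sum_axis) (auto simp: axis_def)

lemma diag_part_ket_nth:
  assumes "bounded_clinear A"
  shows "diag_part A (ket h) $ m = (if m = h then A (ket h) $ m else 0)"
proof -
  have "ketbra g g (ket h) = (if g = h then ket h else 0)" for g
    by (auto simp: ketbra_def cinner_ket ket_nth)
  then have "diag_part A (ket h) $ m = (\<Sum>g\<in>UNIV. if g = h then (if m = h then A (ket h) $ m else 0) else 0)"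
    unfolding diag_part_def sum_component
    by (intro sum.cong)
      (auto simp: ketbra_def cinner_ket ket_nth scaleC_vec_def scaleC_complex_def
        bounded_clinear_simps(4)[OF assms])
  then show ?thesis by simp
qed

lemma self_adjoint_diagonal_real:
  assumes "self_adjoint A"
  shows "cnj (A (ket h) $ h) = A (ket h) $ h"
proof -
  have "cinner (A (ket h)) (ket h) = cinner (ket h) (A (ket h))"
    using assms by (simp add: self_adjoint_def)
  then show ?thesis
    using cinner_commute[of "A (ket h)" "ket h"] by (simp add: cinner_ket)
qed

text \<open>This provides the self-adjoint frame Hamiltonian with which dynamical closedness is
  exhibited.\<close>

lemma self_adjoint_diagonal:
  fixes d :: "'g::finite \<Rightarrow> complex"
  assumes "\<And>k. cnj (d k) = d k"
  shows "self_adjoint (\<lambda>\<psi>. \<chi> k. d k * \<psi> $ k)"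
proof -
  have "linear (\<lambda>\<psi>. \<chi> k. d k * \<psi> $ k)"
    by (rule linearI) (simp_all add: vec_eq_iff algebra_simps)
  then have "bounded_linear (\<lambda>\<psi>. \<chi> k. d k * \<psi> $ k)"
    by (simp add: linear_conv_bounded_linear)
  with assms show ?thesis
    by (simp add: self_adjoint_def bounded_clinear_def vec_eq_iff scaleC_vec_def
        scaleC_complex_def cinner_vec_def cinner_complex_def mult_ac)
qed

section \<open>Vanishing off-diagonal and non-invariant parts\<close>

lemma offdiag_part_tensor_id_eq_0_iff:
  fixes A :: "(complex, 'g::finite) vec \<Rightarrow> (complex, 'g) vec" and \<psi>\<^sub>0 :: "'s::chilbert_space"
  assumes "bounded_clinear A" and "\<psi>\<^sub>0 \<noteq> 0"
  shows "offdiag_part A \<otimes>\<^sub>o (id :: 's \<Rightarrow> 's) = (\<lambda>_. 0) \<longleftrightarrow> (\<forall>m h. m \<noteq> h \<longrightarrow> A (ket h) $ m = 0)"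
proof -
  have entry: "offdiag_part A (ket h) $ m = (if m = h then 0 else A (ket h) $ m)" for m h
    by (simp add: offdiag_part_def diag_part_ket_nth[OF assms(1)])
  show ?thesis
  proof
    assume zero: "offdiag_part A \<otimes>\<^sub>o (id :: 's \<Rightarrow> 's) = (\<lambda>_. 0)"
    show "\<forall>m h. m \<noteq> h \<longrightarrow> A (ket h) $ m = 0"
    proof (intro allI impI)
      fix m h :: 'g
      assume "m \<noteq> h"
      \<comment> \<open>Each block is a multiple of the identity, so the single nonzero vector
        \<open>\<psi>\<^sub>0\<close> detects whether its coefficient vanishes.\<close>
      have "(offdiag_part A \<otimes>\<^sub>o (id :: 's \<Rightarrow> 's)) (axis h \<psi>\<^sub>0) $ m
          = (offdiag_part A (ket h) $ m) *\<^sub>C \<psi>\<^sub>0"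
        unfolding tensor_op_id_right_nth by (subst sum_axis) auto
      with zero \<open>m \<noteq> h\<close> assms(2) show "A (ket h) $ m = 0"
        by (simp add: entry scaleC_eq_0_iff)
    qed
  next
    assume "\<forall>m h. m \<noteq> h \<longrightarrow> A (ket h) $ m = 0"
    then have "offdiag_part A (ket h) $ m = 0" for m h
      by (simp add: entry)
    then show "offdiag_part A \<otimes>\<^sub>o (id :: 's \<Rightarrow> 's) = (\<lambda>_. 0)"
      by (simp add: fun_eq_iff vec_eq_iff tensor_op_id_right_nth)
  qed
qed

lemma id_tensor_noninv_part_eq_0_iff:
  fixes H :: "'s::chilbert_space \<Rightarrow> 's"
    and U :: "'g::{finite,ab_group_add} \<Rightarrow> 's \<Rightarrow> 's"
  shows "(id :: (complex, 'g) vec \<Rightarrow> (complex, 'g) vec) \<otimes>\<^sub>o noninv_part U H = (\<lambda>_. 0)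
    \<longleftrightarrow> inv_part U H = H"
proof
  assume zero: "(id :: (complex, 'g) vec \<Rightarrow> (complex, 'g) vec) \<otimes>\<^sub>o noninv_part U H = (\<lambda>_. 0)"
  show "inv_part U H = H"
  proof
    fix \<psi>
    have "noninv_part U H \<psi> = 0"
      \<comment> \<open>The operator acts componentwise, so component 0 of a constant vector shows
        the action on \<open>\<psi>\<close>.\<close>
      using tensor_op_id_left_nth[of "noninv_part U H" "\<chi> g::'g. \<psi>" 0] zero by simp
    then show "inv_part U H \<psi> = H \<psi>"
      by (simp add: noninv_part_def)
  qed
qed (simp add: fun_eq_iff vec_eq_iff tensor_op_id_left_nth noninv_part_def)

text \<open>In general a scalar can be shifted between the two summands of a non-interacting
  operator. Here \<open>A\<close> and \<open>diag_part A\<close> share their diagonal entries, which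
  rules out a shift: a diagonal block gives equality of the system parts, and the off-diagonal
  blocks then force \<open>A\<close> to be diagonal.\<close>

lemma noninteracting_parts_eq_iff:
  fixes A :: "(complex, 'g::{finite,ab_group_add}) vec \<Rightarrow> (complex, 'g) vec"
    and B :: "'s::chilbert_space \<Rightarrow> 's" and \<psi>\<^sub>0 :: 's
  assumes A: "bounded_clinear A" and "\<psi>\<^sub>0 \<noteq> 0"
  shows "noninteracting A B = noninteracting (diag_part A) (inv_part U B)
    \<longleftrightarrow> (\<forall>m h. m \<noteq> h \<longrightarrow> A (ket h) $ m = 0) \<and> inv_part U B = B"
proof
  assume eq: "noninteracting A B = noninteracting (diag_part A) (inv_part U B)"
  have "inv_part U B \<psi> = B \<psi>" for \<psi>
    using noninteracting_axis_nth[of A B 0 \<psi> 0]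
      noninteracting_axis_nth[of "diag_part A" "inv_part U B" 0 \<psi> 0]
    by (simp add: eq diag_part_ket_nth[OF A])
  then have inv: "inv_part U B = B" by blast
  moreover have "A (ket h) $ m = 0" if "m \<noteq> h" for m h
    using noninteracting_axis_nth[of A B h \<psi>\<^sub>0 m]
      noninteracting_axis_nth[of "diag_part A" B h \<psi>\<^sub>0 m] that eq \<open>\<psi>\<^sub>0 \<noteq> 0\<close>
    by (simp add: inv diag_part_ket_nth[OF A] scaleC_eq_0_iff)
  ultimately show "(\<forall>m h. m \<noteq> h \<longrightarrow> A (ket h) $ m = 0) \<and> inv_part U B = B" by blast
next
  assume diag: "(\<forall>m h. m \<noteq> h \<longrightarrow> A (ket h) $ m = 0) \<and> inv_part U B = B"
  then have "diag_part A (ket h) $ m = A (ket h) $ m" for m h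
    by (simp add: diag_part_ket_nth[OF A])
  with diag show "noninteracting A B = noninteracting (diag_part A) (inv_part U B)"
    by (simp add: fun_eq_iff vec_eq_iff noninteracting_nth)
qed

section \<open>Conjugation by the representation and group averages\<close>

lemma unitary_rep_bounded_clinear: "unitary_rep U \<Longrightarrow> bounded_clinear (U g)"
  by (simp add: unitary_rep_def unitary_op_def)

lemma unitary_rep_add: "unitary_rep U \<Longrightarrow> U g (U h \<psi>) = U (g + h) \<psi>"
  by (simp add: unitary_rep_def)

lemma unitary_rep_0: "unitary_rep U \<Longrightarrow> U 0 \<psi> = \<psi>"
  by (simp add: unitary_rep_def)

text \<open>Conjugation by \<open>U h\<close> only shifts the summation index from \<open>g\<close>
  to \<open>h + g\<close>.\<close>

lemma inv_part_conjugate: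
  assumes "unitary_rep U"
  shows "U h (inv_part U H (U (- h) \<psi>)) = inv_part U H \<psi>"
proof -
  note simps = bounded_clinear_simps[OF unitary_rep_bounded_clinear[OF assms]]
    unitary_rep_add[OF assms]
  have "U h (\<Sum>g\<in>UNIV. U g (H (U (- g) (U (- h) \<psi>)))) = (\<Sum>g\<in>UNIV. U (h + g) (H (U (- (h + g)) \<psi>)))"
    by (simp add: simps algebra_simps)
  also have "\<dots> = (\<Sum>g\<in>UNIV. U g (H (U (- g) \<psi>)))"
    by (rule sum.reindex_bij_witness[of _ "\<lambda>g. g - h" "\<lambda>g. h + g"]) auto
  finally show ?thesis
    by (simp add: inv_part_def simps(3))
qed

lemma inv_part_eq_self_if_scalar_conjugates:
  fixes U :: "'g::{finite,ab_group_add} \<Rightarrow> 's::chilbert_space \<Rightarrow> 's"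
  assumes U: "unitary_rep U"
    and conj: "\<And>g \<psi>. U g (H (U (- g) \<psi>)) = H \<psi> + c g *\<^sub>C \<psi>"
  shows "inv_part U H = H"
proof -
  define \<mu> where "\<mu> = complex_of_real (1 / real CARD('g)) * sum c UNIV"
  have avg: "inv_part U H \<psi> = H \<psi> + \<mu> *\<^sub>C \<psi>" for \<psi>
  proof -
    have "inv_part U H \<psi> = (1 / real CARD('g)) *\<^sub>R (real CARD('g) *\<^sub>R H \<psi> + sum c UNIV *\<^sub>C \<psi>)"
      by (simp add: inv_part_def conj sum.distrib scaleC_sum_left sum_constant_scaleR)
    also have "\<dots> = H \<psi> + (1 / real CARD('g)) *\<^sub>R (sum c UNIV *\<^sub>C \<psi>)"
      by (simp add: scaleR_add_right)
    finally show ?thesis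
      by (simp only: \<mu>_def scaleC_scaleC[symmetric] scaleC_of_real)
  qed
  then have H: "H \<psi> = inv_part U H \<psi> + (- \<mu>) *\<^sub>C \<psi>" for \<psi>
    by (simp add: scaleC_minus_left)
  \<comment> \<open>Conjugation fixes both terms of \<open>H\<close>: the average by the index
    shift, the scalar because \<open>U g\<close> is complex-linear. So every conjugate of
    \<open>H\<close> is \<open>H\<close>, and so is their mean.\<close>
  have "U g (H (U (- g) \<psi>)) = H \<psi>" for g \<psi>
  proof -
    have "U g (H (U (- g) \<psi>)) = U g (inv_part U H (U (- g) \<psi>)) + (- \<mu>) *\<^sub>C U g (U (- g) \<psi>)"
      by (subst H) (simp only: bounded_clinear_simps(1,2)[OF unitary_rep_bounded_clinear[OF U]])
    also have "\<dots> = H \<psi>"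
      by (subst H) (simp add: inv_part_conjugate[OF U] unitary_rep_add[OF U] unitary_rep_0[OF U])
    finally show ?thesis .
  qed
  then show ?thesis
    by (simp add: fun_eq_iff inv_part_def sum_constant_scaleR)
qed

section \<open>The Hamiltonian relative to the other frame\<close>

lemma changed_hamiltonian_noninteracting_nth:
  fixes U :: "'g::{finite,ab_group_add} \<Rightarrow> 's::chilbert_space \<Rightarrow> 's"
  assumes U: "unitary_rep U"
  shows "changed_hamiltonian U g\<^sub>i g\<^sub>j (noninteracting A B) \<Psi> $ k
    = (\<Sum>l\<in>UNIV. (A (ket (g\<^sub>j + g\<^sub>i - l)) $ (g\<^sub>j + g\<^sub>i - k)) *\<^sub>C U (k - l) (\<Psi> $ l))
      + U (k - g\<^sub>i) (B (U (- (k - g\<^sub>i)) (\<Psi> $ k)))"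
proof -
  let ?V = "frame_change U g\<^sub>i g\<^sub>j"
  \<comment> \<open>The frame change moves component \<open>g\<^sub>j + g\<^sub>i - k\<close> to
    component \<open>k\<close>, twisted by \<open>U (k - g\<^sub>i)\<close>. Solving for the
    preimage of \<open>\<Psi>\<close> gives \<open>\<Phi>\<close>; by unitarity it is the adjoint
    applied to \<open>\<Psi>\<close>.\<close>
  define \<Phi> where "\<Phi> = (\<chi> m. U (m - g\<^sub>j) (\<Psi> $ (g\<^sub>j + g\<^sub>i - m)))"
  have nth: "?V \<Xi> $ k = U (k - g\<^sub>i) (\<Xi> $ (g\<^sub>j + g\<^sub>i - k))" for \<Xi> k
    using frame_change_nth[OF U, of g\<^sub>i g\<^sub>j \<Xi> "k - g\<^sub>i"] by (simp add: algebra_simps)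
  have "?V \<Phi> = \<Psi>"
    by (simp add: vec_eq_iff nth \<Phi>_def unitary_rep_add[OF U] unitary_rep_0[OF U] algebra_simps)
  then have adj: "cadjoint ?V \<Psi> = \<Phi>"
    using cadjoint_unitary(1)[OF unitary_frame_change[OF U]] by metis
  \<comment> \<open>For \<open>h = g\<^sub>j + g\<^sub>i - l\<close> the twists
    \<open>U (k - g\<^sub>i)\<close> and \<open>U (g\<^sub>i - l)\<close> combine to
    \<open>U (k - l)\<close>.\<close>
  have "(\<Sum>h\<in>UNIV. (A (ket h) $ (g\<^sub>j + g\<^sub>i - k)) *\<^sub>C U (k - g\<^sub>i) (\<Phi> $ h))
      = (\<Sum>l\<in>UNIV. (A (ket (g\<^sub>j + g\<^sub>i - l)) $ (g\<^sub>j + g\<^sub>i - k)) *\<^sub>C U (k - l) (\<Psi> $ l))"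
    by (rule sum.reindex_bij_witness[of _ "\<lambda>l. g\<^sub>j + g\<^sub>i - l" "\<lambda>l. g\<^sub>j + g\<^sub>i - l"])
      (auto simp: \<Phi>_def unitary_rep_add[OF U] algebra_simps)
  moreover have "\<Phi> $ (g\<^sub>j + g\<^sub>i - k) = U (- (k - g\<^sub>i)) (\<Psi> $ k)"
    by (simp add: \<Phi>_def)
  ultimately show ?thesis
    by (simp add: changed_hamiltonian_def adj nth noninteracting_nth
        bounded_clinear_simps[OF unitary_rep_bounded_clinear[OF U]] del: minus_diff_eq)
qed

text \<open>Both equivalences of the theorem pass through this entrywise criterion: their right-hand
  sides translate into it, or into its negation, without reference to the frame change.\<close>

lemma dynamically_closed_changed_hamiltonian_iff:
  fixes U :: "'g::{finite,ab_group_add} \<Rightarrow> 's::chilbert_space \<Rightarrow> 's"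
  assumes U: "unitary_rep U"
    and non_scalar: "\<And>g c. g \<noteq> 0 \<Longrightarrow> U g \<noteq> (\<lambda>\<psi>. c *\<^sub>C \<psi>)"
    and A: "self_adjoint A" and B: "self_adjoint B"
  shows "dynamically_closed (changed_hamiltonian U g\<^sub>i g\<^sub>j (noninteracting A B))
    \<longleftrightarrow> (\<forall>m h. m \<noteq> h \<longrightarrow> A (ket h) $ m = 0) \<and> inv_part U B = B"
    (is "dynamically_closed ?H \<longleftrightarrow> _")
proof
  let ?a = "\<lambda>m h. A (ket h) $ m" and ?c = "g\<^sub>j + g\<^sub>i"
  assume "dynamically_closed ?H"
  then obtain A' B' where B': "self_adjoint B'" and H: "?H = noninteracting A' B'"
    unfolding dynamically_closed_def by blast
  have zero: "B 0 = 0" "B' 0 = 0" "U g 0 = 0" for g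
    using B B' unitary_rep_bounded_clinear[OF U] unfolding self_adjoint_def
    by (blast intro: bounded_clinear_simps(4))+
  \<comment> \<open>Block \<open>(k, l)\<close> of \<open>?H\<close> computed in two ways, from the
    frame change and from the assumed non-interacting form, by evaluation on
    \<open>axis l \<psi>\<close>.\<close>
  have entry: "?a (?c - k) (?c - l) *\<^sub>C U (k - l) \<psi>
        + (if k = l then U (k - g\<^sub>i) (B (U (- (k - g\<^sub>i)) \<psi>)) else 0)
      = (A' (ket l) $ k) *\<^sub>C \<psi> + (if k = l then B' \<psi> else 0)" for k l \<psi>
  proof -
    have "(\<Sum>h\<in>UNIV. ?a (?c - k) (?c - h) *\<^sub>C U (k - h) (axis l \<psi> $ h))
        = ?a (?c - k) (?c - l) *\<^sub>C U (k - l) \<psi>"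
      by (rule sum_axis) (simp add: zero)
    moreover have "axis l \<psi> $ k = (if k = l then \<psi> else 0)"
      by (auto simp: axis_def)
    ultimately have "?H (axis l \<psi>) $ k = ?a (?c - k) (?c - l) *\<^sub>C U (k - l) \<psi>
        + (if k = l then U (k - g\<^sub>i) (B (U (- (k - g\<^sub>i)) \<psi>)) else 0)"
      unfolding changed_hamiltonian_noninteracting_nth[OF U] by (simp add: zero)
    then show ?thesis
      by (auto simp: H noninteracting_axis_nth zero)
  qed
  have "?a m h = 0" if "m \<noteq> h" for m h
  proof (rule ccontr)
    assume nz: "?a m h \<noteq> 0"
    \<comment> \<open>In the block with \<open>k = ?c - m\<close> and \<open>l = ?c - h\<close> the
      twist is \<open>U (h - m)\<close>. Dividing by the nonzero entry would make it scalar.\<close>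
    let ?b = "A' (ket (?c - h)) $ (?c - m)"
    have "U (h - m) \<psi> = (?b / ?a m h) *\<^sub>C \<psi>" for \<psi>
    proof -
      have "?a m h *\<^sub>C U (h - m) \<psi> = ?b *\<^sub>C \<psi>"
        using entry[where k = "?c - m" and l = "?c - h" and \<psi> = \<psi>] that by simp
      then have "(inverse (?a m h) * ?a m h) *\<^sub>C U (h - m) \<psi> = (inverse (?a m h) * ?b) *\<^sub>C \<psi>"
        by (metis scaleC_scaleC)
      with nz show ?thesis
        by (simp add: field_simps)
    qed
    with non_scalar[of "h - m" "?b / ?a m h"] that show False
      by auto
  qed
  moreover have "inv_part U B = B"
  proof (rule inv_part_eq_self_if_scalar_conjugates[OF U])
    fix g \<psi>
    \<comment> \<open>The choice \<open>k = l = h + g\<^sub>i\<close> makes \<open>h\<close> the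
      conjugating element.\<close>
    have diag: "?a (g\<^sub>j - h) (g\<^sub>j - h) *\<^sub>C \<psi> + U h (B (U (- h) \<psi>))
        = (A' (ket (h + g\<^sub>i)) $ (h + g\<^sub>i)) *\<^sub>C \<psi> + B' \<psi>" for h
      using entry[of "h + g\<^sub>i" "h + g\<^sub>i" \<psi>] by (simp add: unitary_rep_0[OF U])
    \<comment> \<open>Subtracting the case \<open>h = 0\<close>, where the conjugate is
      \<open>B\<close> itself, eliminates \<open>B'\<close> and leaves this scalar.\<close>
    show "U g (B (U (- g) \<psi>)) = B \<psi>
        + ((A' (ket (g + g\<^sub>i)) $ (g + g\<^sub>i) - ?a (g\<^sub>j - g) (g\<^sub>j - g))
          - (A' (ket g\<^sub>i) $ g\<^sub>i - ?a g\<^sub>j g\<^sub>j)) *\<^sub>C \<psi>"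
      using diag[of g] diag[of 0]
      by (simp add: scaleC_diff_left unitary_rep_0[OF U]) (simp add: algebra_simps)
  qed
  ultimately show "(\<forall>m h. m \<noteq> h \<longrightarrow> ?a m h = 0) \<and> inv_part U B = B" by blast
next
  let ?c = "g\<^sub>j + g\<^sub>i"
  \<comment> \<open>The new frame Hamiltonian is the diagonal of \<open>A\<close> reindexed by
    \<open>k \<mapsto> ?c - k\<close>; on the diagonal the twist is \<open>U 0\<close>, the
    identity.\<close>
  define A' :: "(complex, 'g) vec \<Rightarrow> (complex, 'g) vec"
    where "A' = (\<lambda>\<psi>. \<chi> k. (A (ket (?c - k)) $ (?c - k)) * \<psi> $ k)"
  assume diag: "(\<forall>m h. m \<noteq> h \<longrightarrow> A (ket h) $ m = 0) \<and> inv_part U B = B"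
  have entries: "(A (ket (?c - l)) $ (?c - k)) *\<^sub>C U (k - l) \<psi> = (A' (ket l) $ k) *\<^sub>C \<psi>" for k l \<psi>
    using diag by (cases "k = l") (auto simp: A'_def ket_nth unitary_rep_0[OF U])
  \<comment> \<open>\<open>B\<close> is its own group average, hence fixed by conjugation.\<close>
  have "U g (B (U (- g) \<psi>)) = B \<psi>" for g \<psi>
    using inv_part_conjugate[OF U, of g B \<psi>] diag by simp
  then have "?H = noninteracting A' B"
    by (simp add: fun_eq_iff vec_eq_iff changed_hamiltonian_noninteracting_nth[OF U]
        noninteracting_nth entries del: minus_diff_eq)
  moreover have "self_adjoint A'"
    unfolding A'_def by (intro self_adjoint_diagonal self_adjoint_diagonal_real A)
  ultimately show "dynamically_closed ?H"
    using B unfolding dynamically_closed_def by blast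
qed

theorem lemma8:
  fixes U :: "'g::{finite,ab_group_add} \<Rightarrow> 's::chilbert_space \<Rightarrow> 's"
    and H\<^sub>j :: "(complex, 'g) vec \<Rightarrow> (complex, 'g) vec"
    and H\<^sub>S :: "'s \<Rightarrow> 's"
    and H :: "('s, 'g) vec \<Rightarrow> ('s, 'g) vec"
    and g\<^sub>i g\<^sub>j :: 'g
  assumes nontrivial: "\<exists>g::'g. g \<noteq> 0"
    and rep: "unitary_rep U"
    and non_scalar: "\<And>g c. g \<noteq> 0 \<Longrightarrow> U g \<noteq> (\<lambda>\<psi>. c *\<^sub>C \<psi>)"
    and "self_adjoint H\<^sub>j" and "self_adjoint H\<^sub>S"
    and closed_i: "H = noninteracting H\<^sub>j H\<^sub>S"
  shows "(dynamically_closed (changed_hamiltonian U g\<^sub>i g\<^sub>j H) \<longleftrightarrow>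
           H = noninteracting (diag_part H\<^sub>j) (inv_part U H\<^sub>S)) \<and>
         (dynamically_open (changed_hamiltonian U g\<^sub>i g\<^sub>j H) \<longleftrightarrow>
           offdiag_part H\<^sub>j \<otimes>\<^sub>o (id :: 's \<Rightarrow> 's) \<noteq> (\<lambda>_. 0) \<or>
           (id :: (complex, 'g) vec \<Rightarrow> (complex, 'g) vec) \<otimes>\<^sub>o noninv_part U H\<^sub>S \<noteq> (\<lambda>_. 0))"
proof -
  \<comment> \<open>On the zero space every \<open>U g\<close> would be multiplication by 1, which
    \<open>non_scalar\<close> forbids for the nonzero element given by
    \<open>nontrivial\<close>.\<close>
  obtain \<psi>\<^sub>0 :: 's where nz: "\<psi>\<^sub>0 \<noteq> 0"
  proof (rule ccontr)
    assume "\<not> thesis"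
    with that have "\<psi> = 0" for \<psi> :: 's
      by blast
    then have "U g = (\<lambda>\<psi>. 1 *\<^sub>C \<psi>)" for g
      by (metis ext)
    with nontrivial non_scalar show False
      by blast
  qed
  have lin: "bounded_clinear H\<^sub>j"
    using \<open>self_adjoint H\<^sub>j\<close> by (simp add: self_adjoint_def)
  have "dynamically_closed (changed_hamiltonian U g\<^sub>i g\<^sub>j H)
      \<longleftrightarrow> (\<forall>m h. m \<noteq> h \<longrightarrow> H\<^sub>j (ket h) $ m = 0) \<and> inv_part U H\<^sub>S = H\<^sub>S"
    unfolding closed_i
    by (intro dynamically_closed_changed_hamiltonian_iff rep non_scalar
        \<open>self_adjoint H\<^sub>j\<close> \<open>self_adjoint H\<^sub>S\<close>)
  then show ?thesis
    unfolding dynamically_open_def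
    using noninteracting_parts_eq_iff[OF lin nz, of H\<^sub>S U] offdiag_part_tensor_id_eq_0_iff[OF lin nz]
      id_tensor_noninv_part_eq_0_iff[of U H\<^sub>S]
    unfolding closed_i by argo
qed

end
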